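(* Let $n\ge 3$, and let $A_0A_1\ldots A_{n-1}$ and $C_0C_1\ldots C_{n-1}$ be given convex polygons in the Euclidean plane. Then the number of convex polygons $B_0B_1\ldots B_{n-1}$ that are inscribed into $A_0A_1\ldots A_{n-1}$ and circumscribed around $C_0C_1\ldots C_{n-1}$ is at most $4$.
   Context: All indices are taken modulo $n$. A convex $n$-gon is given by its vertices listed in cyclic order, and it is non-degenerate (no three vertices are collinear). A polygon $B_0B_1\ldots B_{n-1}$ is inscribed into $A_0A_1\ldots A_{n-1}$ if for every $i=0,1,\ldots,n-1$ the point $B_i$ lies on the side $A_iA_{i+1}$, strictly between $A_i$ and $A_{i+1}$ (so $B_i\neq A_i,A_{i+1}$). A polygon $B_0B_1\ldots B_{n-1}$ is circumscribed around $C_0C_1\ldots C_{n-1}$ if there is an integer $k$ (an index shift, not depending on $i$ but allowed to depend on the polygon $B_0B_1\ldots B_{n-1}$) such that for every $i=0,1,\ldots,n-1$ the point $C_i$ lies on the side $B_{k+i}B_{k+i+1}$, strictly between $B_{k+i}$ and $B_{k+i+1}$. *)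

theory Defs
  imports "HOL-Analysis.Analysis"
begin

text \<open>
  A polygon is the list of its vertices in cyclic order. Indices are natural numbers read modulo
  the length of the list.
\<close>

definition vertex :: "(real^2) list \<Rightarrow> nat \<Rightarrow> real^2" where
  "vertex P i = P ! (i mod length P)"

text \<open>
  The frontier condition expresses both convexity and that the list is in cyclic order: the closed
  polygonal line through the vertices is the boundary of their convex hull. For
  self-intersecting orderings such as a pentagram it fails. Either orientation is allowed.
\<close>

definition convex_ngon :: "nat \<Rightarrow> (real^2) list \<Rightarrow> bool" where
  "convex_ngon n P \<longleftrightarrow>
     n \<ge> 3 \<and> length P = n \<and>
     (\<forall>i j k. i < j \<and> j < k \<and> k < n \<longrightarrow>
        \<not> collinear {vertex P i, vertex P j, vertex P k}) \<and>
     frontier (convex hull (set P)) =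
       (\<Union>i<n. closed_segment (vertex P i) (vertex P (i + 1)))"

definition inscribed :: "nat \<Rightarrow> (real^2) list \<Rightarrow> (real^2) list \<Rightarrow> bool" where
  "inscribed n B A \<longleftrightarrow>
     (\<forall>i<n. vertex B i \<in> open_segment (vertex A i) (vertex A (i + 1)))"

text \<open>
  As the indices of \<open>B\<close> are read modulo \<open>n\<close>, quantifying over natural shifts \<open>k\<close> covers all
  integer shifts.
\<close>

definition circumscribed :: "nat \<Rightarrow> (real^2) list \<Rightarrow> (real^2) list \<Rightarrow> bool" where
  "circumscribed n B C \<longleftrightarrow>
     (\<exists>k. \<forall>i<n. vertex C i \<in> open_segment (vertex B (k + i)) (vertex B (k + i + 1)))"

end

theory Submission
  imports Defs
begin

text \<open>
  Write \<open>B i = (1 - t i) A i + t i A (i + 1)\<close>, so that an inscribed polygon is a cyclic sequence of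
  parameters in the open unit interval. The bound \<open>4\<close> is \<open>2 \<cdot> 2\<close>: at most two index shifts \<open>k\<close> can
  occur, and each of them admits at most two polygons.

  For a fixed shift, every side of \<open>B\<close> cuts off a corner of \<open>A\<close> and passes through a prescribed point
  inside that corner. In barycentric coordinates this reads \<open>a / (1 - t i) + b / t (i + 1) = 1\<close> with
  \<open>a, b > 0\<close> (\<open>chord_equation\<close>), and therefore \<open>t (i + 1)\<close> is an increasing, strictly convex
  function of \<open>t i\<close>. Going once around the polygon composes such functions, so a solution is a
  fixed point of an increasing strictly convex function, and there are at most two of them
  (\<open>solutions_subset_doubleton\<close>).

  For the number of shifts, the side through \<open>C 0\<close> shows that \<open>C 0\<close> lies in the open ear
  \<open>A k, A (k + 1), A (k + 2)\<close>. If \<open>n \<ge> 4\<close>, two ears of a convex polygon are disjoint unless they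
  are adjacent (\<open>ears_meet_only_if_adjacent\<close>), and no three of at least four cyclically arranged
  indices are pairwise adjacent.

  If \<open>n = 3\<close> all ears coincide and a different reason is needed. Solutions with different shifts are
  strictly ordered by their parameters: if one chord lay nearer to the corner than the other, the
  point of \<open>C\<close> on it would be cut off by the other. Hence, passing from a smaller to a larger
  solution, the chord at every corner of \<open>A\<close> turns in the same sense, and the contact points of the
  two chords differ by a vector whose coordinates have a known sign pattern. The patterns at
  consecutive corners are incompatible when all three shifts occur
  (\<open>no_solutions_for_three_shifts_triangle\<close>).
\<close>

section \<open>Signed areas and barycentric coordinates\<close>

text \<open>
  Twice the signed area of the triangle \<open>P Q R\<close>.
\<close>

definition orient :: "real^2 \<Rightarrow> real^2 \<Rightarrow> real^2 \<Rightarrow> real" where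
  "orient P Q R = (Q$1 - P$1) * (R$2 - P$2) - (Q$2 - P$2) * (R$1 - P$1)"

text \<open>
  The barycentric coordinate of \<open>X\<close> at the corner \<open>P\<close> of the triangle \<open>P Q R\<close>; the coordinates at
  the other corners arise by rotating the arguments. Being a ratio of signed areas, it is affine
  in \<open>X\<close>.
\<close>

definition bary :: "real^2 \<Rightarrow> real^2 \<Rightarrow> real^2 \<Rightarrow> real^2 \<Rightarrow> real" where
  "bary P Q R X = orient Q R X / orient P Q R"

lemma orient_rotate: "orient Q R P = orient P Q R"
  by (simp add: orient_def algebra_simps)

lemma orient_degenerate [simp]: "orient P P Q = 0" "orient P Q P = 0" "orient P Q Q = 0"
  by (simp_all add: orient_def)

lemma orient_affine:
  "orient P Q ((1 - s) *\<^sub>R X + s *\<^sub>R Y) = (1 - s) * orient P Q X + s * orient P Q Y"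
  by (simp add: orient_def algebra_simps)

lemma parallel_if_cross_zero:
  fixes u v :: "real^2"
  assumes "u$1 * v$2 = u$2 * v$1" "u \<noteq> 0"
  shows "\<exists>c. v = c *\<^sub>R u"
proof -
  have "u$1 \<noteq> 0 \<or> u$2 \<noteq> 0"
    using assms(2) by (simp add: vec_eq_iff forall_2)
  then show ?thesis
  proof
    assume "u$1 \<noteq> 0"
    then have "v = (v$1 / u$1) *\<^sub>R u"
      using assms(1) by (simp add: vec_eq_iff forall_2 field_simps)
    then show ?thesis by (rule exI)
  next
    assume "u$2 \<noteq> 0"
    then have "v = (v$2 / u$2) *\<^sub>R u"
      using assms(1) by (simp add: vec_eq_iff forall_2 field_simps)
    then show ?thesis by (rule exI)
  qed
qed

lemma orient_nonzero_if_not_collinear: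
  assumes "\<not> collinear {P, Q, R}"
  shows "orient P Q R \<noteq> 0"
proof
  assume 0: "orient P Q R = 0"
  have "Q - P = 0 \<or> (\<exists>c. R - P = c *\<^sub>R (Q - P))"
    using parallel_if_cross_zero[of "Q - P" "R - P"] 0 by (auto simp: orient_def)
  then have "collinear {0, Q - P, R - P}"
    by (auto simp: collinear_lemma)
  then have "collinear {Q, P, R}"
    by (subst collinear_3) simp_all
  then show False
    using assms by (simp add: insert_commute)
qed

lemma bary_affine:
  "bary P Q R ((1 - s) *\<^sub>R X + s *\<^sub>R Y) = (1 - s) * bary P Q R X + s * bary P Q R Y"
  by (simp add: bary_def orient_affine add_divide_distrib)

lemma bary_vertices:
  assumes "orient P Q R \<noteq> 0"
  shows "bary P Q R P = 1" "bary P Q R Q = 0" "bary P Q R R = 0"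
  using assms by (simp_all add: bary_def orient_rotate)

lemma open_segment_param:
  assumes "X \<in> open_segment P Q"
  obtains s where "0 < s" "s < 1" "X = (1 - s) *\<^sub>R P + s *\<^sub>R Q"
  using assms by (auto simp: in_segment)

text \<open>
  In the affine frame with origin \<open>Q\<close> and axes towards \<open>P\<close> and \<open>R\<close>, the chord \<open>B B'\<close> has the intercepts
  \<open>1 - t\<close> and \<open>u\<close>. The equation is the intercept form of that line.
\<close>

lemma chord_equation:
  assumes "orient P Q R \<noteq> 0"
    and t: "0 < t" "t < 1" "B = (1 - t) *\<^sub>R P + t *\<^sub>R Q"
    and u: "0 < u" "u < 1" "B' = (1 - u) *\<^sub>R Q + u *\<^sub>R R"
    and X: "X \<in> open_segment B B'"
  shows "0 < bary P Q R X" "0 < bary R P Q X"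
    "bary P Q R X / (1 - t) + bary R P Q X / u = 1"
proof -
  obtain s where s: "0 < s" "s < 1" "X = (1 - s) *\<^sub>R B + s *\<^sub>R B'"
    using X by (rule open_segment_param)
  have "orient R P Q \<noteq> 0"
    using assms(1) by (simp add: orient_rotate)
  note v = bary_vertices[OF assms(1)] bary_vertices[OF this]
  have 1: "bary P Q R X = (1 - s) * (1 - t)" "bary R P Q X = s * u"
    unfolding s(3) t(3) u(3) bary_affine v by simp_all
  then show "0 < bary P Q R X" "0 < bary R P Q X"
    "bary P Q R X / (1 - t) + bary R P Q X / u = 1"
    using s(1,2) t(1,2) u(1,2) by simp_all
qed

section \<open>Cyclic indices\<close>

lemma vertex_mod: "length P = n \<Longrightarrow> vertex P (i mod n) = vertex P i"
  by (simp add: vertex_def)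

lemma vertex_cong: "length P = n \<Longrightarrow> i mod n = j mod n \<Longrightarrow> vertex P i = vertex P j"
  by (simp add: vertex_def)

lemma convex_ngon_orient_nonzero:
  assumes "convex_ngon n A" "i mod n \<noteq> j mod n" "j mod n \<noteq> k mod n" "i mod n \<noteq> k mod n"
  shows "orient (vertex A i) (vertex A j) (vertex A k) \<noteq> 0"
proof -
  have n: "n > 0" and len: "length A = n"
    and nc: "\<And>i j k. i < j \<Longrightarrow> j < k \<Longrightarrow> k < n \<Longrightarrow> \<not> collinear {vertex A i, vertex A j, vertex A k}"
    using assms(1) by (auto simp: convex_ngon_def)
  define i' j' k' where "i' = i mod n" and "j' = j mod n" and "k' = k mod n"
  have l: "i' < n" "j' < n" "k' < n" and d: "i' \<noteq> j'" "j' \<noteq> k'" "i' \<noteq> k'"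
    using n assms by (simp_all add: i'_def j'_def k'_def)
  consider "i' < j' \<and> j' < k'" | "i' < k' \<and> k' < j'" | "j' < i' \<and> i' < k'"
    | "j' < k' \<and> k' < i'" | "k' < i' \<and> i' < j'" | "k' < j' \<and> j' < i'"
    using d by linarith
  then have "\<not> collinear {vertex A i', vertex A j', vertex A k'}"
    by cases (use nc l in \<open>fastforce simp: insert_commute\<close>)+
  then show ?thesis
    using orient_nonzero_if_not_collinear
    by (simp add: i'_def j'_def k'_def vertex_mod[OF len])
qed

text \<open>
  For \<open>n \<ge> 3\<close> three consecutive indices stay distinct modulo \<open>n\<close>.
\<close>

lemma convex_ngon_corner:
  assumes "convex_ngon n A"
  shows "orient (vertex A i) (vertex A (i + 1)) (vertex A (i + 2)) \<noteq> 0"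
proof -
  have n: "n \<ge> 3" using assms by (simp add: convex_ngon_def)
  have "(i + a) mod n \<noteq> (i + b) mod n" if "a < b" "b < 3" for a b
  proof
    assume "(i + a) mod n = (i + b) mod n"
    then have "n dvd (i + b) - (i + a)"
      using that by (subst (asm) eq_commute, subst (asm) mod_eq_dvd_iff_nat) simp_all
    then show False
      using that n by (auto dest: dvd_imp_le)
  qed
  from this[of 0 1] this[of 1 2] this[of 0 2] show ?thesis
    by (intro convex_ngon_orient_nonzero[OF assms]) simp_all
qed

text \<open>
  The parameters are extended periodically to all natural indices, so that relations between
  neighbours can be followed around the polygon without wrapping the index.
\<close>

lemma inscribed_param:
  assumes "length A = n" "length B = n" "n > 0" "inscribed n B A"
  obtains t where "\<And>i. 0 < t i" "\<And>i. t i < (1::real)"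
    "\<And>i. vertex B i = (1 - t i) *\<^sub>R vertex A i + t i *\<^sub>R vertex A (i + 1)"
    "\<And>i. t (i mod n) = t i"
proof -
  have "\<exists>t. 0 < t \<and> t < 1 \<and> vertex B i = (1 - t) *\<^sub>R vertex A i + t *\<^sub>R vertex A (i + 1)"
    if "i < n" for i
    using assms(4) that unfolding inscribed_def by (meson open_segment_param)
  then obtain f where f: "\<And>i. i < n \<Longrightarrow> 0 < f i \<and> f i < 1 \<and>
      vertex B i = (1 - f i) *\<^sub>R vertex A i + f i *\<^sub>R vertex A (i + 1)"
    by metis
  have v: "vertex A (i mod n + 1) = vertex A (i + 1)" for i
    by (rule vertex_cong[OF assms(1)]) (simp add: mod_simps)
  show ?thesis
  proof (rule that[of "\<lambda>i. f (i mod n)"])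
    fix i
    have "i mod n < n" using assms(3) by simp
    note F = f[OF this]
    show "0 < f (i mod n)" "f (i mod n) < 1" using F by simp_all
    show "vertex B i = (1 - f (i mod n)) *\<^sub>R vertex A i + f (i mod n) *\<^sub>R vertex A (i + 1)"
      using F unfolding v vertex_mod[OF assms(1)] vertex_mod[OF assms(2)] by blast
  qed simp
qed

text \<open>
  Here the shift \<open>k\<close> is part of the data, and \<open>i\<close> ranges over all natural numbers, which makes the
  contact conditions an infinite periodic system.
\<close>

definition solutions :: "nat \<Rightarrow> (real^2) list \<Rightarrow> (real^2) list \<Rightarrow> nat \<Rightarrow> (real^2) list set" where
  "solutions n A C k = {B. length B = n \<and> inscribed n B A \<and>
     (\<forall>i. vertex C i \<in> open_segment (vertex B (k + i)) (vertex B (k + i + 1)))}"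

lemma solution_param:
  assumes A: "convex_ngon n A" and B: "B \<in> solutions n A C k"
  obtains t where "\<And>i. 0 < t i" "\<And>i. t i < (1::real)"
    "\<And>i. vertex B i = (1 - t i) *\<^sub>R vertex A i + t i *\<^sub>R vertex A (i + 1)"
    "\<And>i. t (i mod n) = t i"
    "\<And>i. 0 < bary (vertex A (k+i)) (vertex A (k+i+1)) (vertex A (k+i+2)) (vertex C i)"
    "\<And>i. 0 < bary (vertex A (k+i+2)) (vertex A (k+i)) (vertex A (k+i+1)) (vertex C i)"
    "\<And>i. bary (vertex A (k+i)) (vertex A (k+i+1)) (vertex A (k+i+2)) (vertex C i) / (1 - t (k+i))
        + bary (vertex A (k+i+2)) (vertex A (k+i)) (vertex A (k+i+1)) (vertex C i) / t (k+i+1) = 1"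
proof -
  have *: "length A = n" "length B = n" "n > 0" "inscribed n B A"
    using A B by (auto simp: convex_ngon_def solutions_def)
  obtain t where t: "\<And>i. 0 < t i" "\<And>i. t i < (1::real)"
    "\<And>i. vertex B i = (1 - t i) *\<^sub>R vertex A i + t i *\<^sub>R vertex A (i + 1)"
    "\<And>i. t (i mod n) = t i"
    using inscribed_param[OF *] by blast
  have "vertex C i \<in> open_segment (vertex B (k + i)) (vertex B (k + i + 1))" for i
    using B by (simp add: solutions_def)
  note c = chord_equation[OF convex_ngon_corner[OF A, of "k+i" for i]
      t(1)[of "k+i" for i] t(2) t(3) t(1)[of "k+i+1" for i] t(2) _ this]
  have e: "vertex B (k+i+1) = (1 - t (k+i+1)) *\<^sub>R vertex A (k+i+1) + t (k+i+1) *\<^sub>R vertex A (k+i+2)" for i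
    using t(3)[of "k+i+1"] by (simp add: numeral_2_eq_2)
  show ?thesis
    by (rule that[of t, OF t c(1)[OF e] c(2)[OF e] c(3)[OF e]])
qed

section \<open>A fixed shift\<close>

text \<open>
  The chord equation solved for \<open>u\<close>: a hyperbola in \<open>t\<close> with its pole at \<open>1 - a\<close>, to the right of all
  admissible \<open>t\<close>.
\<close>

lemma chord_map:
  fixes a b t u :: real
  assumes "0 < a" "0 < b" "t < 1" "0 < u" "a / (1 - t) + b / u = 1"
  shows "0 < 1 - t - a" "u = b + a * b / (1 - t - a)"
proof -
  have "0 < b / u" using assms by simp
  then have "a / (1 - t) < 1" using assms(5) by linarith
  then show *: "0 < 1 - t - a" using assms(3) by (simp add: field_simps)
  have "a * u + b * (1 - t) = (1 - t) * u"
    using assms(3,4,5) by (simp add: field_simps)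
  then have "u * (1 - t - a) = b * (1 - t - a) + a * b" by (simp add: algebra_simps)
  then show "u = b + a * b / (1 - t - a)" using * by (simp add: field_simps)
qed

text \<open>
  On the admissible range \<open>t \<mapsto> b + a b / (1 - t - a)\<close> is increasing and strictly convex. Convexity is
  stated as growth of the ratio of consecutive gaps, because this form survives composition
  by simple chaining.
\<close>

lemma chord_map_convex:
  fixes a b :: real
  assumes "0 < a" "0 < b"
    and "t1 < 1" "0 < u1" "a / (1 - t1) + b / u1 = 1"
    and "t2 < 1" "0 < u2" "a / (1 - t2) + b / u2 = 1"
    and "t3 < 1" "0 < u3" "a / (1 - t3) + b / u3 = 1"
    and t: "t1 < t2" "t2 < t3"
  shows "u1 < u2" "u2 < u3" "(t3 - t2) / (t2 - t1) < (u3 - u2) / (u2 - u1)"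
proof -
  define w1 w2 w3 where "w1 = 1 - t1 - a" and "w2 = 1 - t2 - a" and "w3 = 1 - t3 - a"
  have w: "0 < w1" "0 < w2" "0 < w3" "w3 < w2" "w2 < w1"
    using chord_map(1)[of a b t1 u1] chord_map(1)[of a b t2 u2] chord_map(1)[of a b t3 u3] assms
    by (simp_all add: w1_def w2_def w3_def)
  have u: "u1 = b + a * b / w1" "u2 = b + a * b / w2" "u3 = b + a * b / w3"
    using chord_map(2)[of a b t1 u1] chord_map(2)[of a b t2 u2] chord_map(2)[of a b t3 u3] assms
    by (simp_all add: w1_def w2_def w3_def)
  have d: "u2 - u1 = a * b * (t2 - t1) / (w1 * w2)" "u3 - u2 = a * b * (t3 - t2) / (w2 * w3)"
    using w unfolding u by (simp_all add: field_simps) (simp_all add: w1_def w2_def w3_def algebra_simps)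
  have ab: "0 < a * b" using assms by simp
  have "0 < u2 - u1" "0 < u3 - u2"
    unfolding d using w t ab by simp_all
  then show "u1 < u2" "u2 < u3" by simp_all
  \<comment> \<open>The common factor \<open>a * b / w2\<close> of the two gaps cancels.\<close>
  have "(u3 - u2) / (u2 - u1) = (t3 - t2) / (t2 - t1) * (w1 / w3)"
    unfolding d using w t assms(1,2) by (simp add: field_simps)
  moreover have "1 < w1 / w3" using w by simp
  moreover have "0 < (t3 - t2) / (t2 - t1)" using t by simp
  ultimately show "(t3 - t2) / (t2 - t1) < (u3 - u2) / (u2 - u1)"
    by (metis mult.right_neutral mult_strict_left_mono)
qed

text \<open>
  An increasing strictly convex map has at most two fixed points: for three cyclic solutions the
  ratio of the two gaps would strictly grow with each step, yet return to its initial value after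
  \<open>n\<close> steps.
\<close>

lemma no_three_cyclic_chains:
  fixes a b t1 t2 t3 :: "nat \<Rightarrow> real"
  assumes "\<And>j. 0 < a j" "\<And>j. 0 < b j"
    and t1: "\<And>j. t1 j < 1" "\<And>j. 0 < t1 j" "\<And>j. a j / (1 - t1 j) + b j / t1 (Suc j) = 1"
    and t2: "\<And>j. t2 j < 1" "\<And>j. 0 < t2 j" "\<And>j. a j / (1 - t2 j) + b j / t2 (Suc j) = 1"
    and t3: "\<And>j. t3 j < 1" "\<And>j. 0 < t3 j" "\<And>j. a j / (1 - t3 j) + b j / t3 (Suc j) = 1"
    and "t1 0 < t2 0" "t2 0 < t3 0"
    and "n > 0" "t1 n = t1 0" "t2 n = t2 0" "t3 n = t3 0"
  shows False
proof -
  define r where "r j = (t3 j - t2 j) / (t2 j - t1 j)" for j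
  note step = chord_map_convex[OF assms(1,2) t1(1,2,3) t2(1,2,3) t3(1,2,3)]
  have ord: "t1 j < t2 j \<and> t2 j < t3 j" for j
    by (induction j) (use assms step in auto)
  then have "r j < r (Suc j)" for j
    unfolding r_def using step(3) by blast
  then have "r 0 < r n"
    using \<open>n > 0\<close> by (rule lift_Suc_mono_less)
  then show False
    using assms by (simp add: r_def)
qed

lemma subset_doubleton_if_no_three:
  assumes "\<And>x y z. x \<in> S \<Longrightarrow> y \<in> S \<Longrightarrow> z \<in> S \<Longrightarrow> x \<noteq> y \<Longrightarrow> y \<noteq> z \<Longrightarrow> x \<noteq> z \<Longrightarrow> False"
  shows "\<exists>x y. S \<subseteq> {x, y}"
  using assms by (metis insertCI subsetI)

text \<open>
  Numbering the sides of \<open>A\<close> from \<open>k\<close> on turns a solution into a cyclic chain for the coefficients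
  given by \<open>C\<close>. The parameter on side \<open>k\<close> determines the whole chain, so distinct solutions can be
  sorted by it.
\<close>

lemma solutions_subset_doubleton:
  assumes A: "convex_ngon n A" and k: "k < n"
  shows "\<exists>x y. solutions n A C k \<subseteq> {x, y}"
proof -
  have n: "n > 0" and lA: "length A = n" using A by (auto simp: convex_ngon_def)
  define a where "a i = bary (vertex A (k+i)) (vertex A (k+i+1)) (vertex A (k+i+2)) (vertex C i)" for i
  define b where "b i = bary (vertex A (k+i+2)) (vertex A (k+i)) (vertex A (k+i+1)) (vertex C i)" for i
  define chain where "chain B t \<longleftrightarrow> (\<forall>i. 0 < t i \<and> t i < 1 \<and> t (i + n) = t i \<and>
      a i / (1 - t i) + b i / t (Suc i) = 1 \<and>
      vertex B (k + i) = (1 - t i) *\<^sub>R vertex A (k+i) + t i *\<^sub>R vertex A (k+i+1)) \<and>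
      (\<forall>i. 0 < a i \<and> 0 < b i) \<and> length B = n" for B and t :: "nat \<Rightarrow> real"
  have ex: "\<exists>t. chain B t" if B: "B \<in> solutions n A C k" for B
  proof -
    from solution_param[OF A B] obtain t where t: "\<And>i. 0 < t i" "\<And>i. t i < (1::real)"
      "\<And>i. vertex B i = (1 - t i) *\<^sub>R vertex A i + t i *\<^sub>R vertex A (i + 1)"
      "\<And>i. t (i mod n) = t i" "\<And>i. 0 < a i" "\<And>i. 0 < b i"
      "\<And>i. a i / (1 - t (k+i)) + b i / t (k+i+1) = 1"
      unfolding a_def b_def by blast
    have "t (k + (i + n)) = t (k + i)" for i
      by (metis t(4) add.assoc mod_add_self2)
    then have "chain B (\<lambda>i. t (k + i))"
      using t B by (auto simp: chain_def solutions_def)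
    then show ?thesis by (rule exI[where x = "\<lambda>i. t (k + i)"])
  qed
  have inj: "B = B'" if "chain B t" "chain B' t'" "t 0 = t' 0" for B B' t t'
  proof -
    have eq: "t i = t' i" for i
    proof (induction i)
      case (Suc i)
      have "t (Suc i) = b i + a i * b i / (1 - t i - a i)" "t' (Suc i) = b i + a i * b i / (1 - t' i - a i)"
        using that(1,2) by (auto simp: chain_def intro!: chord_map(2))
      then show ?case using Suc by simp
    qed (use that in simp)
    have v: "vertex B (k + i) = vertex B' (k + i)" for i
      using that(1,2) by (simp add: chain_def eq)
    show ?thesis
    proof (rule nth_equalityI)
      show "length B = length B'" using that by (simp add: chain_def)
      fix i assume "i < length B"
      then have i: "i < n" "length B = n" "length B' = n" using that by (simp_all add: chain_def)
      have "vertex B (i + n) = vertex B' (i + n)"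
        using v[of "i + n - k"] k by simp
      then show "B ! i = B' ! i"
        using i by (simp add: vertex_def)
    qed
  qed
  have no3: False if "chain B1 t1" "chain B2 t2" "chain B3 t3" "t1 0 < t2 0" "t2 0 < t3 0"
    for B1 B2 B3 t1 t2 t3
  proof -
    have "t1 n = t1 0" "t2 n = t2 0" "t3 n = t3 0"
      using that(1-3) unfolding chain_def by (metis add_0)+
    then show False
      by (intro no_three_cyclic_chains[of a b t1 t2 t3 n]) (use that n in \<open>auto simp: chain_def\<close>)
  qed
  show ?thesis
  proof (rule subset_doubleton_if_no_three)
    fix x y z
    assume "x \<in> solutions n A C k" "y \<in> solutions n A C k" "z \<in> solutions n A C k"
      and d: "x \<noteq> y" "y \<noteq> z" "x \<noteq> z"
    then obtain t u v where c: "chain x t" "chain y u" "chain z v" using ex by meson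
    then have "t 0 \<noteq> u 0" "u 0 \<noteq> v 0" "t 0 \<noteq> v 0" using inj d by blast+
    then consider "t 0 < u 0 \<and> u 0 < v 0" | "t 0 < v 0 \<and> v 0 < u 0" | "u 0 < t 0 \<and> t 0 < v 0"
      | "u 0 < v 0 \<and> v 0 < t 0" | "v 0 < t 0 \<and> t 0 < u 0" | "v 0 < u 0 \<and> u 0 < t 0"
      by linarith
    then show False using no3 c by cases blast+
  qed
qed

section \<open>Ears of a convex polygon\<close>

text \<open>
  Every edge point of a convex polygon is a frontier point of the hull, hence has a supporting line.
\<close>

lemma support_functional:
  assumes "convex_ngon n A" "X \<in> closed_segment (vertex A i) (vertex A (i + 1))"
  obtains a :: "real^2" where "a \<noteq> 0" "\<And>l. a \<bullet> X \<le> a \<bullet> vertex A l"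
proof -
  have n: "n > 0" and len: "length A = n"
    and fr: "frontier (convex hull (set A)) =
       (\<Union>i<n. closed_segment (vertex A i) (vertex A (i + 1)))"
    using assms(1) by (auto simp: convex_ngon_def)
  have "vertex A (i mod n + 1) = vertex A (i + 1)"
    by (rule vertex_cong[OF len]) (simp add: mod_simps)
  then have "X \<in> closed_segment (vertex A (i mod n)) (vertex A (i mod n + 1))"
    using assms(2) by (simp only: vertex_mod[OF len])
  then have X: "X \<in> frontier (convex hull (set A))"
    unfolding fr using n by (intro UN_I[of "i mod n"]) simp_all
  let ?S = "convex hull (set A)"
  have "closed ?S"
    by (simp add: compact_imp_closed finite_imp_compact_convex_hull)
  with X have XS: "X \<in> ?S" "X \<notin> interior ?S"
    by (simp_all add: frontier_def)
  have vS: "vertex A l \<in> ?S" for l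
    using n len by (intro hull_inc) (simp add: vertex_def)
  show ?thesis
  \<comment> \<open>A flat hull lies in a line, whose normal is constant on the polygon.\<close>
  proof (cases "interior ?S = {}")
    case True
    then obtain a b where "a \<noteq> 0" "?S \<subseteq> {x. a \<bullet> x = b}"
      using empty_interior_subset_hyperplane[OF convex_convex_hull] by metis
    then show ?thesis
      using XS(1) vS that[of a] by (metis (mono_tags) mem_Collect_eq order_refl subsetD)
  next
    case False
    then have "X \<notin> rel_interior ?S"
      using XS(2) by (simp add: rel_interior_nonempty_interior)
    then obtain a where "a \<noteq> 0" "\<And>y. y \<in> ?S \<Longrightarrow> a \<bullet> X \<le> a \<bullet> y"
      using supporting_hyperplane_rel_boundary[OF convex_convex_hull XS(1)] by metis
    then show ?thesis using vS that by blast
  qed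
qed

text \<open>
  A linear functional that does not distinguish \<open>P\<close> from \<open>Q\<close> measures, up to a factor, the signed
  distance from the line \<open>P Q\<close>.
\<close>

lemma functional_vanishing_on_line:
  fixes a :: "real^2"
  assumes "a \<bullet> (Q - P) = 0" "P \<noteq> Q" "a \<noteq> 0"
  obtains c where "c \<noteq> 0" "\<And>X. a \<bullet> (X - P) = c * orient P Q X"
proof -
  define w :: "real^2" where "w = vector [P$2 - Q$2, Q$1 - P$1]"
  have w: "w$1 = P$2 - Q$2" "w$2 = Q$1 - P$1"
    by (simp_all add: w_def)
  have "w \<noteq> 0"
    using assms(2) w by (auto simp: vec_eq_iff forall_2)
  moreover have "w$1 * a$2 = w$2 * a$1"
    using assms(1) by (simp add: w inner_vec_def sum_2 algebra_simps)
  ultimately obtain c where c: "a = c *\<^sub>R w"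
    using parallel_if_cross_zero by blast
  show ?thesis
  proof (rule that)
    show "c \<noteq> 0" using c assms(3) by auto
    show "a \<bullet> (X - P) = c * orient P Q X" for X
      unfolding c by (simp add: w orient_def inner_vec_def sum_2 algebra_simps)
  qed
qed

text \<open>
  A supporting line at the midpoint of an edge contains both endpoints, so it is the line of the
  edge, and all vertices lie on one side of it.
\<close>

lemma edge_same_side:
  assumes A: "convex_ngon n A"
  shows "0 \<le> orient (vertex A i) (vertex A (i + 1)) (vertex A l) *
    orient (vertex A i) (vertex A (i + 1)) (vertex A m)"
proof -
  let ?P = "vertex A i" and ?Q = "vertex A (i + 1)"
  have ne: "?P \<noteq> ?Q"
    using convex_ngon_corner[OF A, of i] by (metis orient_degenerate(1))
  obtain a where a: "a \<noteq> 0" "\<And>l. a \<bullet> midpoint ?P ?Q \<le> a \<bullet> vertex A l"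
    using support_functional[OF A, of "midpoint ?P ?Q" i] by auto
  have "a \<bullet> midpoint ?P ?Q = (a \<bullet> ?P + a \<bullet> ?Q) / 2"
    by (simp add: midpoint_def inner_add_right inner_scaleR_right)
  then have e: "a \<bullet> ?P = a \<bullet> ?Q" "a \<bullet> midpoint ?P ?Q = a \<bullet> ?P"
    using a(2)[of i] a(2)[of "i + 1"] by simp_all
  obtain c where c: "c \<noteq> 0" "\<And>X. a \<bullet> (X - ?P) = c * orient ?P ?Q X"
    by (rule functional_vanishing_on_line[of a ?Q ?P]) (use e a ne in \<open>auto simp: inner_diff_right\<close>)
  have "0 \<le> c * orient ?P ?Q (vertex A l)" for l
    using a(2)[of l] e unfolding c(2)[symmetric] inner_diff_right by linarith
  from this[of l] this[of m] c(1) show ?thesis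
    by (metis mult_nonneg_nonneg mult_nonpos_nonpos zero_le_mult_iff linorder_neqE_linordered_idom not_less)
qed

text \<open>
  The three areas are the weights of \<open>X\<close> as a positive combination of the corners. A functional
  that is minimal at \<open>X\<close> would then take the same value at all three corners, which forces it to
  vanish.
\<close>

lemma vertex_not_in_triangle:
  assumes A: "convex_ngon n A" and D: "orient P Q R \<noteq> 0"
    and v: "P = vertex A p" "Q = vertex A q" "R = vertex A r"
    and X: "X = vertex A l"
    and pos: "0 < orient Q R X * orient P Q R" "0 < orient R P X * orient P Q R"
      "0 < orient P Q X * orient P Q R"
  shows False
proof -
  obtain a where a: "a \<noteq> 0" "\<And>m. a \<bullet> X \<le> a \<bullet> vertex A m"
    using support_functional[OF A, of X l] X by auto
  let ?D = "orient P Q R"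
  have "orient Q R X *\<^sub>R (P - X) + orient R P X *\<^sub>R (Q - X) + orient P Q X *\<^sub>R (R - X) = 0"
    by (simp add: vec_eq_iff forall_2 orient_def algebra_simps)
  then have "?D * (a \<bullet> (orient Q R X *\<^sub>R (P - X) + orient R P X *\<^sub>R (Q - X) + orient P Q X *\<^sub>R (R - X))) = 0"
    by simp
  then have s: "(orient Q R X * ?D) * (a \<bullet> (P - X)) + (orient R P X * ?D) * (a \<bullet> (Q - X))
      + (orient P Q X * ?D) * (a \<bullet> (R - X)) = 0"
    by (simp add: inner_add_right algebra_simps)
  have nn: "0 \<le> a \<bullet> (P - X)" "0 \<le> a \<bullet> (Q - X)" "0 \<le> a \<bullet> (R - X)"
    using a(2) v by (simp_all add: inner_diff_right)
  have "0 \<le> (orient Q R X * ?D) * (a \<bullet> (P - X))" "0 \<le> (orient R P X * ?D) * (a \<bullet> (Q - X))"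
      "0 \<le> (orient P Q X * ?D) * (a \<bullet> (R - X))"
    using nn pos by simp_all
  then have "(orient Q R X * ?D) * (a \<bullet> (P - X)) = 0" "(orient R P X * ?D) * (a \<bullet> (Q - X)) = 0"
     "(orient P Q X * ?D) * (a \<bullet> (R - X)) = 0"
    using s by linarith+
  then have z: "a \<bullet> (P - X) = 0" "a \<bullet> (Q - X) = 0" "a \<bullet> (R - X) = 0"
    using pos by auto
  then have "a \<bullet> (Q - P) = 0" "a \<bullet> (R - P) = 0"
    by (simp_all add: inner_diff_right)
  moreover have "P \<noteq> Q" using D by auto
  ultimately obtain c where "c \<noteq> 0" "a \<bullet> (R - P) = c * ?D"
    using functional_vanishing_on_line[of a Q P] a(1) by metis
  then show False using D \<open>a \<bullet> (R - P) = 0\<close> by simp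
qed

text \<open>
  The diagonal \<open>A k, A (k + 2)\<close> separates \<open>A (k + 1)\<close> from the other vertices. A vertex on the same
  side as \<open>A (k + 1)\<close> would also be on the inner side of the two edges at \<open>A (k + 1)\<close>, hence inside
  the ear.
\<close>

lemma ear_separated:
  assumes A: "convex_ngon n A" and l: "l mod n \<noteq> (k + 1) mod n"
  shows "bary (vertex A (k+1)) (vertex A (k+2)) (vertex A k) (vertex A l) \<le> 0"
proof (cases "l mod n = k mod n \<or> l mod n = (k + 2) mod n")
  case True
  have len: "length A = n" using A by (simp add: convex_ngon_def)
  have "vertex A l = vertex A k \<or> vertex A l = vertex A (k + 2)"
    using True vertex_cong[OF len] by blast
  then show ?thesis by (auto simp: bary_def)
next
  case False
  have len: "length A = n" and n: "n \<ge> 3" using A by (simp_all add: convex_ngon_def)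
  let ?P = "vertex A k" and ?Q = "vertex A (k+1)" and ?R = "vertex A (k+2)" and ?X = "vertex A l"
  have D: "orient ?P ?Q ?R \<noteq> 0" by (rule convex_ngon_corner[OF A])
  have 1: "0 \<le> orient ?P ?Q ?X * orient ?P ?Q ?R"
    by (rule edge_same_side[OF A])
  have "0 \<le> orient ?Q ?R ?X * orient ?Q ?R ?P"
    using edge_same_side[OF A, of "k+1" l k] by (simp add: numeral_2_eq_2)
  then have 2: "0 \<le> orient ?Q ?R ?X * orient ?P ?Q ?R"
    by (simp add: orient_rotate)
  have "k mod n \<noteq> (k + 1) mod n" "(k + 1) mod n \<noteq> (k + 2) mod n"
    using D vertex_cong[OF len] orient_degenerate by metis+
  then have "orient ?P ?Q ?X \<noteq> 0" "orient ?Q ?R ?X \<noteq> 0"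
    using False l by (metis convex_ngon_orient_nonzero[OF A])+
  then have "0 < orient ?P ?Q ?X * orient ?P ?Q ?R" "0 < orient ?Q ?R ?X * orient ?P ?Q ?R"
    using 1 2 D by (simp_all add: less_le)
  then have "orient ?R ?P ?X * orient ?P ?Q ?R \<le> 0"
    using vertex_not_in_triangle[OF A D refl refl refl refl] by (meson not_less)
  then have "orient ?R ?P ?X / orient ?P ?Q ?R \<le> 0"
    using D by (auto simp: divide_le_0_iff mult_le_0_iff)
  then show ?thesis by (simp add: bary_def orient_rotate)
qed

text \<open>
  Both endpoints of a side of \<open>B\<close> lie on the two edges of one ear of \<open>A\<close>, so a contact point on it is in
  the interior of that ear. The weights are positive and serve every barycentric coordinate, as all
  of these are affine.
\<close>

lemma contact_in_ear:
  assumes A: "convex_ngon n A" and B: "B \<in> solutions n A C k"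
  obtains \<alpha> \<beta> \<gamma> where "0 < \<alpha>" "0 < \<beta>" "0 < \<gamma>"
    "\<And>P Q R. bary P Q R (vertex C i) = \<alpha> * bary P Q R (vertex A (k+i)) +
      \<beta> * bary P Q R (vertex A (k+i+1)) + \<gamma> * bary P Q R (vertex A (k+i+2))"
proof -
  have n: "length A = n" "length B = n" "n > 0" "inscribed n B A"
    using A B by (auto simp: convex_ngon_def solutions_def)
  obtain t where t: "\<And>i. 0 < t i" "\<And>i. t i < (1::real)"
    "\<And>i. vertex B i = (1 - t i) *\<^sub>R vertex A i + t i *\<^sub>R vertex A (i + 1)"
    "\<And>i. t (i mod n) = t i"
    using inscribed_param[OF n] by blast
  have "vertex C i \<in> open_segment (vertex B (k + i)) (vertex B (k + i + 1))"
    using B by (simp add: solutions_def)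
  then obtain s where s: "0 < s" "s < 1"
    "vertex C i = (1 - s) *\<^sub>R vertex B (k + i) + s *\<^sub>R vertex B (k + i + 1)"
    by (rule open_segment_param)
  have v: "vertex A (k + i + 1 + 1) = vertex A (k + i + 2)"
    by (simp add: numeral_2_eq_2)
  show ?thesis
  proof (rule that)
    show "0 < (1 - s) * (1 - t (k + i))"
      using s(1,2) t(1,2) by simp
    show "0 < (1 - s) * t (k + i) + s * (1 - t (k + i + 1))"
      using s(1,2) t(1,2) by (simp add: add_pos_pos)
    show "0 < s * t (k + i + 1)"
      using s(1,2) t(1,2) by simp
    show "bary P Q R (vertex C i) = ((1 - s) * (1 - t (k + i))) * bary P Q R (vertex A (k+i)) +
      ((1 - s) * t (k + i) + s * (1 - t (k + i + 1))) * bary P Q R (vertex A (k+i+1)) +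
      (s * t (k + i + 1)) * bary P Q R (vertex A (k+i+2))" for P Q R
      unfolding s(3) t(3) bary_affine v by (simp add: algebra_simps)
  qed
qed

text \<open>
  The diagonal that cuts off the ear of \<open>k\<close> has that ear strictly on one side, and the ear of \<open>m\<close> on
  the other unless \<open>A (k + 1)\<close> is one of its corners. The point \<open>C 0\<close> would have to be in both ears.
\<close>

lemma ears_meet_only_if_adjacent:
  assumes A: "convex_ngon n A" and "k < m" "m < n" "m \<noteq> k + 1" "k \<noteq> 0 \<or> m + 1 \<noteq> n"
    and "B \<in> solutions n A C k" "B' \<in> solutions n A C m"
  shows False
proof -
  have n: "n \<ge> 3" and len: "length A = n" using A by (simp_all add: convex_ngon_def)
  let ?g = "bary (vertex A (k+1)) (vertex A (k+2)) (vertex A k)"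
  let ?X = "vertex C 0"
  have D: "orient (vertex A (k+1)) (vertex A (k+2)) (vertex A k) \<noteq> 0"
    using convex_ngon_corner[OF A, of k] by (simp add: orient_rotate)
  obtain \<alpha> \<beta> \<gamma> where 1: "0 < \<alpha>" "0 < \<beta>" "0 < \<gamma>"
    "?g ?X = \<alpha> * ?g (vertex A k) + \<beta> * ?g (vertex A (k+1)) + \<gamma> * ?g (vertex A (k+2))"
    using contact_in_ear[OF A assms(6), of 0] by (metis add_0_right)
  then have "0 < ?g ?X"
    by (simp add: bary_vertices[OF D] del: add_2_eq_Suc' One_nat_def add_Suc_right)
  \<comment> \<open>\<open>A (k + 1)\<close> is not a corner of the ear of \<open>m\<close>; the excluded pair \<open>k = 0\<close>, \<open>m = n - 1\<close> is adjacent around the cycle.\<close>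
  have res: "(m + 1) mod n \<noteq> (k + 1) mod n" "(m + 2) mod n \<noteq> (k + 1) mod n" "m mod n \<noteq> (k + 1) mod n"
  proof -
    have "(m + 1) mod n = (if m + 1 = n then 0 else m + 1)"
      "(m + 2) mod n = (if m + 2 < n then m + 2 else m + 2 - n)"
      using assms(3) n by (simp_all add: le_mod_geq)
    moreover have "m mod n = m" "(k + 1) mod n = k + 1"
      using assms(2,3) by simp_all
    ultimately show "(m + 1) mod n \<noteq> (k + 1) mod n" "(m + 2) mod n \<noteq> (k + 1) mod n" "m mod n \<noteq> (k + 1) mod n"
      using assms(2-5) n by auto
  qed
  obtain \<alpha>' \<beta>' \<gamma>' where 2: "0 < \<alpha>'" "0 < \<beta>'" "0 < \<gamma>'"
    "?g ?X = \<alpha>' * ?g (vertex A m) + \<beta>' * ?g (vertex A (m+1)) + \<gamma>' * ?g (vertex A (m+2))"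
    using contact_in_ear[OF A assms(7), of 0] by (metis add_0_right)
  moreover have "?g (vertex A m) \<le> 0" "?g (vertex A (m+1)) \<le> 0" "?g (vertex A (m+2)) \<le> 0"
    using res by (simp_all only: ear_separated[OF A] not_False_eq_True)
  ultimately have "\<alpha>' * ?g (vertex A m) \<le> 0" "\<beta>' * ?g (vertex A (m+1)) \<le> 0"
      "\<gamma>' * ?g (vertex A (m+2)) \<le> 0"
    by (intro mult_nonneg_nonpos; linarith)+
  then have "?g ?X \<le> 0"
    using 2(4) by linarith
  then show False using \<open>0 < ?g ?X\<close> by simp
qed

section \<open>Triangles: at most two shifts\<close>

text \<open>
  With \<open>1 - p\<close> and \<open>q\<close> the intercepts of a chord, the right-hand side is the value of its defining
  function at a point of the side opposite to the corner; the chord does not reach that side.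
\<close>

lemma chord_avoids_opposite_vertex:
  fixes p q r :: real
  assumes "0 < p" "p < 1" "0 < q" "q < 1" "0 < r" "r < 1"
  shows "1 < r / (1 - p) + (1 - r) / q"
proof -
  have "1 < 1 / (1 - p)" "1 < 1 / q"
    using assms by simp_all
  then have "r * 1 < r * (1 / (1 - p))" "(1 - r) * 1 < (1 - r) * (1 / q)"
    using assms by (intro mult_strict_left_mono; simp)+
  then show ?thesis by simp
qed

lemma mod3_cases:
  fixes j e :: nat
  shows "j mod 3 = e mod 3 \<or> j mod 3 = (e + 1) mod 3 \<or> j mod 3 = (e + 2) mod 3"
proof -
  have "j mod 3 < 3" "e mod 3 < 3" by simp_all
  then show ?thesis by (simp add: mod_Suc) linarith
qed

text \<open>
  Modulo \<open>3\<close>, the solution of \<open>k + i = e\<close> is \<open>i = e + 2 k\<close>. With shift \<open>k\<close>, the side of \<open>B\<close> from side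
  \<open>e\<close> to side \<open>e + 1\<close> of \<open>A\<close> therefore carries the point with index \<open>e + 2 k\<close>.
\<close>

lemma contact_index_at_corner:
  fixes k e :: nat
  shows "(k + (e + 2 * k)) mod 3 = e mod 3"
proof -
  have "k + (e + 2 * k) = e + 3 * k" by simp
  then show ?thesis by simp
qed

lemma contact_index_distinct:
  fixes k k' e :: nat
  assumes "k < 3" "k' < 3" "k \<noteq> k'"
  shows "(k + (e + 2 * k')) mod 3 \<noteq> e mod 3"
proof
  assume "(k + (e + 2 * k')) mod 3 = e mod 3"
  moreover have "(k + (e + 2 * k')) mod 3 = (e + (k + 2 * k')) mod 3"
    by (simp add: ac_simps)
  ultimately have "3 dvd k + 2 * k'"
    by (metis add_diff_cancel_left' le_add1 mod_eq_dvd_iff_nat)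
  moreover have "k = 0 \<or> k = 1 \<or> k = 2" "k' = 0 \<or> k' = 1 \<or> k' = 2"
    using assms by linarith+
  ultimately show False using assms(3) by (elim disjE dvdE) (auto, arith+)
qed

text \<open>
  For shift \<open>j\<close>, the contact at the next corner is the contact at the first corner for shift \<open>j + 2\<close>.
\<close>

lemma contact_index_next_corner:
  fixes j :: nat
  shows "(1 + 2 * j) mod 3 = (2 * ((j + 2) mod 3)) mod 3"
proof -
  have "(2 * ((j + 2) mod 3)) mod 3 = ((1 + 2 * j) + 3) mod 3"
    by (simp add: mod_simps)
  then show ?thesis by (simp only: mod_add_self2)
qed

text \<open>
  For a triangle, \<open>corner_coord A m\<close> depends only on \<open>m\<close> modulo \<open>3\<close> and is the barycentric
  coordinate at the corner \<open>A m\<close>.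
\<close>

definition corner_coord :: "(real^2) list \<Rightarrow> nat \<Rightarrow> real^2 \<Rightarrow> real" where
  "corner_coord A m = bary (vertex A m) (vertex A (m+1)) (vertex A (m+2))"

text \<open>
  The parameters \<open>t\<close> describe an inscribed triangle whose chord across the corner \<open>A (e + 1)\<close> has the
  intercepts \<open>1 - t e\<close> and \<open>t (e + 1)\<close>. The last two clauses say that this chord goes through exactly
  one of the three points of \<open>C\<close>, the one assigned by the shift, and that the other two lie strictly
  beyond it as seen from the corner.
\<close>

definition supporting_chords ::
  "(real^2) list \<Rightarrow> (real^2) list \<Rightarrow> nat \<Rightarrow> (nat \<Rightarrow> real) \<Rightarrow> bool" where
  "supporting_chords A C k t \<longleftrightarrow>
     (\<forall>e. 0 < t e \<and> t e < 1 \<and> t (e mod 3) = t e) \<and>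
     (\<forall>i e. 0 \<le> corner_coord A e (vertex C i)) \<and>
     (\<forall>i e. (k + i) mod 3 = e mod 3 \<longrightarrow>
       corner_coord A e (vertex C i) / (1 - t e) + corner_coord A (e+2) (vertex C i) / t (e+1) = 1) \<and>
     (\<forall>i e. (k + i) mod 3 \<noteq> e mod 3 \<longrightarrow>
       1 < corner_coord A e (vertex C i) / (1 - t e) + corner_coord A (e+2) (vertex C i) / t (e+1))"

text \<open>
  The defining function of a chord equals \<open>1\<close> at its two endpoints and exceeds \<open>1\<close> at the third vertex
  of \<open>B\<close>. A point of \<open>C\<close> on another side of \<open>B\<close> is a proper mixture of one endpoint with the third
  vertex.
\<close>

lemma triangle_solution_supporting_chords:
  assumes A: "convex_ngon 3 A" and B: "B \<in> solutions 3 A C k"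
  shows "\<exists>t. supporting_chords A C k t"
proof -
  define L where "L = corner_coord A"
  have lA: "length A = 3" and lB: "length B = 3" and iB: "inscribed 3 B A"
    using A B by (simp_all add: convex_ngon_def solutions_def)
  obtain t where t: "\<And>i. 0 < t i" "\<And>i. t i < (1::real)"
    "\<And>i. vertex B i = (1 - t i) *\<^sub>R vertex A i + t i *\<^sub>R vertex A (i + 1)"
    "\<And>i. t (i mod 3) = t i"
    using inscribed_param[OF lA lB zero_less_numeral iB] by blast
  define F where "F e X = L e X / (1 - t e) + L (e+2) X / t (e+1)" for e X
  have per: "vertex A (e + 3) = vertex A e" "vertex A (e + 4) = vertex A (e + 1)" for e
  proof -
    show "vertex A (e + 3) = vertex A e"
      by (rule vertex_cong[OF lA]) simp
    have "e + 4 = (e + 1) + 3" by simp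
    then show "vertex A (e + 4) = vertex A (e + 1)"
      by (intro vertex_cong[OF lA]) (simp only: mod_add_self2)
  qed
  have L2: "L (e + 2) = bary (vertex A (e+2)) (vertex A e) (vertex A (e+1))" for e
    unfolding L_def corner_coord_def using per[of e] by (simp add: add.assoc numeral_eq_Suc)
  have D: "orient (vertex A e) (vertex A (e+1)) (vertex A (e+2)) \<noteq> 0" for e
    by (rule convex_ngon_corner[OF A])
  have D2: "orient (vertex A (e+2)) (vertex A e) (vertex A (e+1)) \<noteq> 0" for e
    using D by (simp add: orient_rotate)
  have F_affine: "F e ((1 - s) *\<^sub>R X + s *\<^sub>R Y) = (1 - s) * F e X + s * F e Y" for e s X Y
    unfolding F_def L_def corner_coord_def bary_affine
    by (simp add: add_divide_distrib distrib_left)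
  have vB2: "vertex B (e+1) = (1 - t (e+1)) *\<^sub>R vertex A (e+1) + t (e+1) *\<^sub>R vertex A (e+2)"
     "vertex B (e+2) = (1 - t (e+2)) *\<^sub>R vertex A (e+2) + t (e+2) *\<^sub>R vertex A e" for e
    using t(3)[of "e+1"] t(3)[of "e+2"] per(1)[of e] by (simp_all add: numeral_eq_Suc)
  have LA: "L e (vertex A e) = 1" "L e (vertex A (e+1)) = 0" "L e (vertex A (e+2)) = 0"
    "L (e+2) (vertex A e) = 0" "L (e+2) (vertex A (e+1)) = 0" "L (e+2) (vertex A (e+2)) = 1" for e
    unfolding L2 unfolding L_def corner_coord_def by (rule bary_vertices[OF D] bary_vertices[OF D2])+
  have FA: "F e (vertex A e) = 1 / (1 - t e)" "F e (vertex A (e+1)) = 0"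
     "F e (vertex A (e+2)) = 1 / t (e+1)" for e
    by (simp_all add: F_def LA del: add_2_eq_Suc' One_nat_def add_Suc_right)
  have "F e (vertex B e) = (1 - t e) * (1 / (1 - t e)) + t e * 0" for e
    unfolding t(3) F_affine FA ..
  then have FB0: "F e (vertex B e) = 1" for e
    using t(2)[of e] by simp
  have "F e (vertex B (e+1)) = (1 - t (e+1)) * 0 + t (e+1) * (1 / t (e+1))" for e
    unfolding vB2 F_affine FA ..
  then have FB1: "F e (vertex B (e+1)) = 1" for e
    using t(1)[of "e+1"] by simp
  have "F e (vertex B (e+2)) = (1 - t (e+2)) * (1 / t (e+1)) + t (e+2) * (1 / (1 - t e))" for e
    unfolding vB2 F_affine FA ..
  then have FB2: "1 < F e (vertex B (e+2))" for e
    using chord_avoids_opposite_vertex[OF t(1)[of e] t(2) t(1)[of "e+1"] t(2) t(1)[of "e+2"] t(2)]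
    by (simp add: add.commute)
  have LB: "0 \<le> L e (vertex B j)" for e j
  proof -
    have "0 \<le> L e (vertex A j)" for j
    proof -
      have "vertex A j = vertex A e \<or> vertex A j = vertex A (e+1) \<or> vertex A j = vertex A (e+2)"
        using vertex_cong[OF lA, of j e] vertex_cong[OF lA, of j "e+1"]
          vertex_cong[OF lA, of j "e+2"] mod3_cases[of j e] by blast
      then have "L e (vertex A j) = 1 \<or> L e (vertex A j) = 0"
        using LA(1-3)[of e] by metis
      then show ?thesis by auto
    qed
    then show ?thesis
      unfolding t(3) L_def corner_coord_def bary_affine using t(1,2)[of j] by (simp add: less_imp_le)
  qed
  have C: "0 \<le> L e (vertex C i)" (is ?nonneg)
    "(k + i) mod 3 = e mod 3 \<Longrightarrow> F e (vertex C i) = 1" (is "?on \<Longrightarrow> _")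
    "(k + i) mod 3 \<noteq> e mod 3 \<Longrightarrow> 1 < F e (vertex C i)" (is "?off \<Longrightarrow> _") for i e
  proof -
    have "vertex C i \<in> open_segment (vertex B (k + i)) (vertex B (k + i + 1))"
      using B by (simp add: solutions_def)
    then obtain s where s: "0 < s" "s < 1"
      "vertex C i = (1 - s) *\<^sub>R vertex B (k + i) + s *\<^sub>R vertex B (k + i + 1)"
      by (rule open_segment_param)
    show ?nonneg
      unfolding s(3) using LB s(1,2) by (simp add: L_def corner_coord_def bary_affine)
    show "F e (vertex C i) = 1" if ?on
    proof -
      have "vertex B (k + i) = vertex B e" "vertex B (k + i + 1) = vertex B (e + 1)"
        using vertex_cong[OF lB that] vertex_cong[OF lB mod_add_cong[OF that refl]] by blast+
      then show ?thesis
        unfolding s(3) F_affine by (simp add: FB0 FB1[unfolded Suc_eq_plus1[symmetric]])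
    qed
    show "1 < F e (vertex C i)" if ?off
    proof -
      have succ: "(a + 1) mod 3 = (b + 1) mod 3" if "a mod 3 = b mod 3" for a b :: nat
        using that by (rule mod_add_cong) simp
      have two: "e + 1 + 1 = e + 2" and three: "(e + 2 + 1) mod 3 = e mod 3"
        by simp_all
      have "(k + i) mod 3 = (e+1) mod 3 \<or> (k + i) mod 3 = (e+2) mod 3"
        using that mod3_cases by blast
      then consider "(k + i) mod 3 = (e+1) mod 3" "(k + i + 1) mod 3 = (e+2) mod 3"
        | "(k + i) mod 3 = (e+2) mod 3" "(k + i + 1) mod 3 = e mod 3"
        using succ[of "k + i" "e + 1"] succ[of "k + i" "e + 2"] two three by metis
      then show ?thesis
      proof cases
        case 1
        then have a: "F e (vertex B (k + i)) = 1" "1 < F e (vertex B (k + i + 1))"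
          using FB1[of e] FB2[of e] vertex_cong[OF lB 1(1)] vertex_cong[OF lB 1(2)] by simp_all
        then have "s * 1 < s * F e (vertex B (k + i + 1))" using s by simp
        then show ?thesis unfolding s(3) F_affine using a by simp
      next
        case 2
        then have a: "1 < F e (vertex B (k + i))" "F e (vertex B (k + i + 1)) = 1"
          using FB0[of e] FB2[of e] vertex_cong[OF lB 2(1)] vertex_cong[OF lB 2(2)] by simp_all
        then have "(1 - s) * 1 < (1 - s) * F e (vertex B (k + i))" using s by simp
        then show ?thesis unfolding s(3) F_affine using a by simp
      qed
    qed
  qed
  show ?thesis
    unfolding supporting_chords_def
    by (intro exI[of _ t] conjI allI impI)
      (assumption | rule t(1,2,4) C[unfolded F_def L_def])+
qed

text \<open>
  The lines \<open>x / p + y / q = 1\<close> and \<open>x / p' + y / q' = 1\<close> cross, the primed one being the other turned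
  towards the second axis. Each of the two points is on its own line and beyond the other line, so
  they lie on different sides of the crossing, and the step between them has the sign pattern of
  the directions of the two lines.
\<close>

lemma chords_cross:
  fixes p p' q q' a b a' b' :: real
  assumes "0 < p'" "p' < p" "0 < q" "q < q'"
    and "a / p + b / q = 1" "1 < a' / p + b' / q"
    and "a' / p' + b' / q' = 1" "1 < a / p' + b / q'"
  shows "a' < a" "b < b'"
proof -
  define x y where "x = a' - a" and "y = b' - b"
  have "0 < x / p + y / q" "x / p' + y / q' < 0"
    using assms(5-8) by (simp_all add: x_def y_def diff_divide_distrib)
  then have 1: "0 < x * q + y * p" "x * q' + y * p' < 0"
    using assms(1-4) by (simp_all add: field_simps)
  have det: "p' * q < p * q'"
    using assms(1-4) by (intro mult_strict_mono) simp_all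
  have "0 < (x * q + y * p) * q'" "(x * q' + y * p') * q < 0"
    using 1 assms(1-4) by (simp_all add: mult_pos_pos mult_neg_pos)
  then have "0 < y * (p * q' - p' * q)"
    by (simp add: algebra_simps)
  then show y: "b < b'"
    using det by (simp add: y_def zero_less_mult_iff)
  have "x * q' < 0"
    using 1(2) y assms(1) by (smt (verit) mult_pos_pos y_def)
  then show "a' < a"
    using assms(3,4) by (simp add: x_def mult_less_0_iff)
qed

text \<open>
  Solutions for two different shifts are comparable at all corners at once, and then
  \<open>chords_cross\<close> fixes the signs of two coordinates of the difference of their contact points at
  every corner. Each of the coordinates occurs at two corners with opposite signs, while the
  contact points are permuted cyclically from corner to corner. Comparing the coordinate at
  \<open>A 0\<close> for the three points of \<open>C\<close> gives a contradiction.
\<close>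

lemma no_solutions_for_three_shifts_triangle:
  assumes A: "convex_ngon 3 A" and lC: "length C = 3" and B: "\<And>k. k < 3 \<Longrightarrow> solutions 3 A C k \<noteq> {}"
  shows False
proof -
  define L where "L = corner_coord A"
  have "\<exists>t. supporting_chords A C k t" if "k < 3" for k
    using B[OF that] triangle_solution_supporting_chords[OF A] by blast
  then obtain t where t: "\<And>k. k < 3 \<Longrightarrow> supporting_chords A C k (t k)"
    by metis
  \<comment> \<open>The contact point at the corner \<open>A (e + 1)\<close> of the solution with shift \<open>k\<close>.\<close>
  define y where "y k e = vertex C (e + 2 * k)" for k e
  have contact: "L e (y k e) / (1 - t k e) + L (e+2) (y k e) / t k (e+1) = 1" if "k < 3" for k e
  proof -
    have "(k + (e + 2 * k)) mod 3 = e mod 3" by (rule contact_index_at_corner)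
    then show ?thesis using t[OF that] unfolding supporting_chords_def y_def L_def by blast
  qed
  have inner: "1 < L e (y k' e) / (1 - t k e) + L (e+2) (y k' e) / t k (e+1)"
    if "k < 3" "k' < 3" "k \<noteq> k'" for k k' e
  proof -
    have "(k + (e + 2 * k')) mod 3 \<noteq> e mod 3" by (rule contact_index_distinct[OF that])
    then show ?thesis using t[OF that(1)] unfolding supporting_chords_def y_def L_def by blast
  qed
  have bounds: "0 < t k e" "t k e < 1" "t k (e mod 3) = t k e" "0 \<le> L e (y k' e')"
    if "k < 3" for k k' e e'
    using t[OF that] unfolding supporting_chords_def y_def L_def by blast+
  have period: "t k (e + 3) = t k e" if "k < 3" for k e
    by (metis bounds(3)[OF that] mod_add_self2)
  \<comment> \<open>Otherwise the chord of shift \<open>k'\<close> would be at least as near to the corner as that of shift \<open>k\<close>, although its contact point lies strictly beyond the latter.\<close>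
  have lift: "t k (e+1) < t k' (e+1)" if k: "k < 3" "k' < 3" "k \<noteq> k'" and le: "t k e \<le> t k' e" for k k' e
  proof (rule ccontr)
    assume "\<not> ?thesis"
    then have "L e (y k' e) / (1 - t k e) \<le> L e (y k' e) / (1 - t k' e)"
      "L (e+2) (y k' e) / t k (e+1) \<le> L (e+2) (y k' e) / t k' (e+1)"
      using bounds[OF k(1)] bounds[OF k(2)] le by (auto intro!: divide_left_mono)
    then show False
      using inner[OF k, of e] contact[OF k(2), of e] by linarith
  qed
  have ordered: "t k e < t k' e" if k: "k < 3" "k' < 3" "k \<noteq> k'" and le: "t k 0 \<le> t k' 0" for k k' e
  proof -
    have "t k (Suc e) < t k' (Suc e)" for e
      by (induction e) (use lift[OF k, of 0] lift[OF k, of "Suc e" for e] le in \<open>simp_all add: less_imp_le\<close>)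
    moreover have "Suc (e + 2) = e + 3" by simp
    ultimately show ?thesis
      using period[OF k(1)] period[OF k(2)] by metis
  qed
  have cone: "L e (y k' e) < L e (y k e)" "L (e+2) (y k e) < L (e+2) (y k' e)"
    if k: "k < 3" "k' < 3" "k \<noteq> k'" and le: "t k 0 \<le> t k' 0" for k k' e
  proof -
    have "1 - t k' e < 1 - t k e" "t k (e+1) < t k' (e+1)"
      using ordered[OF k le] by simp_all
    then show "L e (y k' e) < L e (y k e)" "L (e+2) (y k e) < L (e+2) (y k' e)"
      using chords_cross[of "1 - t k' e" "1 - t k e" "t k (e+1)" "t k' (e+1)"
          "L e (y k e)" "L (e+2) (y k e)" "L e (y k' e)" "L (e+2) (y k' e)"]
        contact[OF k(1), of e] contact[OF k(2), of e] inner[OF k, of e] inner[OF k(2,1) k(3)[symmetric], of e]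
        bounds[OF k(1)] bounds[OF k(2)]
      by simp_all
  qed
  \<comment> \<open>The coordinate at \<open>A 0\<close> decreases along the step at the corner \<open>A 1\<close> and increases along the step at \<open>A 2\<close>.\<close>
  define z where "z k = L 0 (vertex C (2 * k))" for k
  have lA: "length A = 3" using A by (simp add: convex_ngon_def)
  have L3: "L 3 = L 0"
    unfolding L_def corner_coord_def fun_eq_iff using vertex_cong[OF lA, of 3 0] vertex_cong[OF lA, of "3 + 1" "0 + 1"]
      vertex_cong[OF lA, of "3 + 2" "0 + 2"] by simp
  have z: "z k' < z k \<and> z ((k + 2) mod 3) < z ((k' + 2) mod 3)"
    if k: "k < 3" "k' < 3" "k \<noteq> k'" and le: "t k 0 \<le> t k' 0" for k k'
  proof -
    have "y j 1 = vertex C (2 * ((j + 2) mod 3))" for j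
      unfolding y_def by (rule vertex_cong[OF lC contact_index_next_corner])
    moreover have "(1::nat) + 2 = 3" by simp
    ultimately have "z ((j + 2) mod 3) = L (1 + 2) (y j 1)" for j
      using L3 by (simp only: z_def)
    then have "z ((k + 2) mod 3) < z ((k' + 2) mod 3)"
      using cone(2)[OF k le, of 1] by (simp only:)
    moreover have "z k' < z k"
      using cone(1)[OF k le, of 0] by (simp only: z_def y_def add_0)
    ultimately show ?thesis by simp
  qed
  \<comment> \<open>Each pair of shifts makes one of the three values extremal: all three would be strict maxima or strict minima.\<close>
  have "(z 1 < z 0 \<and> z 2 < z 0) \<or> (z 0 < z 1 \<and> z 0 < z 2)"
    using z[of 0 1] z[of 1 0] linear[of "t 0 0" "t 1 0"] by (auto simp: numeral_2_eq_2)
  moreover have "(z 2 < z 0 \<and> z 2 < z 1) \<or> (z 0 < z 2 \<and> z 1 < z 2)"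
    using z[of 0 2] z[of 2 0] linear[of "t 0 0" "t 2 0"] by (auto simp: numeral_2_eq_2)
  moreover have "(z 2 < z 1 \<and> z 0 < z 1) \<or> (z 1 < z 2 \<and> z 1 < z 0)"
    using z[of 1 2] z[of 2 1] linear[of "t 1 0" "t 2 0"] by (auto simp: numeral_2_eq_2)
  ultimately show False by linarith
qed

section \<open>Counting\<close>

text \<open>
  Three indices on a cycle of length at least \<open>4\<close> are never pairwise adjacent.
\<close>

lemma shifts_subset_doubleton:
  assumes A: "convex_ngon n A" and C: "length C = n"
  shows "\<exists>k l. {k. k < n \<and> solutions n A C k \<noteq> {}} \<subseteq> {k, l}"
proof -
  have n: "n \<ge> 3" using A by (simp add: convex_ngon_def)
  define K where "K = {k. k < n \<and> solutions n A C k \<noteq> {}}"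
  have no3: False if "k \<in> K" "l \<in> K" "m \<in> K" "k < l" "l < m" for k l m
  proof (cases "n = 3")
    case True
    then have "k = 0" "l = 1" "m = 2" using that by (simp_all add: K_def)
    then have "solutions 3 A C j \<noteq> {}" if "j < 3" for j
      using that \<open>k \<in> K\<close> \<open>l \<in> K\<close> \<open>m \<in> K\<close> True by (auto simp: K_def numeral_3_eq_3 less_Suc_eq numeral_2_eq_2)
    then show False
      using A C unfolding True by (intro no_solutions_for_three_shifts_triangle[of A C])
  next
    case False
    have adj: "j = i + 1 \<or> i = 0 \<and> j + 1 = n" if ij: "i \<in> K" "j \<in> K" "i < j" for i j
    proof (rule ccontr)
      assume n: "\<not> ?thesis"
      obtain B B' where "B \<in> solutions n A C i" "B' \<in> solutions n A C j" "j < n"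
        using ij(1,2) unfolding K_def by blast
      then show False
        using ears_meet_only_if_adjacent[OF A \<open>i < j\<close>] n by blast
    qed
    show False
      using adj[OF that(1,2,4)] adj[OF that(2,3,5)] adj[OF that(1,3)] that(4,5) n False that(3)
      by (auto simp: K_def)
  qed
  have "\<exists>k l. K \<subseteq> {k, l}"
  proof (rule subset_doubleton_if_no_three)
    fix k l m assume "k \<in> K" "l \<in> K" "m \<in> K" "k \<noteq> l" "l \<noteq> m" "k \<noteq> m"
    moreover from this consider "k < l \<and> l < m" | "k < m \<and> m < l" | "l < k \<and> k < m"
      | "l < m \<and> m < k" | "m < k \<and> k < l" | "m < l \<and> l < k"
      by linarith
    ultimately show False using no3 by cases blast+
  qed
  then show ?thesis by (simp add: K_def)
qed

theorem theorem2p2: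
  fixes n :: nat and A C :: "(real^2) list"
  assumes "n \<ge> 3" and "convex_ngon n A" and "convex_ngon n C"
  shows "finite {B. convex_ngon n B \<and> inscribed n B A \<and> circumscribed n B C} \<and>
         card {B. convex_ngon n B \<and> inscribed n B A \<and> circumscribed n B C} \<le> 4"
proof -
  let ?S = "{B. convex_ngon n B \<and> inscribed n B A \<and> circumscribed n B C}"
  have sub: "\<exists>k<n. B \<in> solutions n A C k" if B: "B \<in> ?S" for B
  proof -
    have len: "length B = n" and ins: "inscribed n B A" using B by (auto simp: convex_ngon_def)
    have lC: "length C = n" using assms(3) by (simp add: convex_ngon_def)
    obtain k where k: "\<And>i. i < n \<Longrightarrow> vertex C i \<in> open_segment (vertex B (k + i)) (vertex B (k + i + 1))"
      using B by (auto simp: circumscribed_def)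
    \<comment> \<open>Reducing the shift modulo \<open>n\<close> leaves finitely many shifts to consider.\<close>
    have "vertex C i \<in> open_segment (vertex B (k mod n + i)) (vertex B (k mod n + i + 1))" for i
    proof -
      have "(k mod n + i) mod n = (k + i mod n) mod n"
        by (simp add: mod_simps)
      then have "vertex B (k mod n + i) = vertex B (k + i mod n)"
        "vertex B (k mod n + i + 1) = vertex B (k + i mod n + 1)"
        by (rule vertex_cong[OF len], rule vertex_cong[OF len mod_add_cong[OF _ refl]])
      then show ?thesis
        using k[of "i mod n"] assms(1) by (simp only: vertex_mod[OF lC]) simp
    qed
    then have "B \<in> solutions n A C (k mod n)"
      using len ins by (simp add: solutions_def)
    then show ?thesis
      using assms(1) by (intro exI[of _ "k mod n"]) simp
  qed
  obtain k l where kl: "{k. k < n \<and> solutions n A C k \<noteq> {}} \<subseteq> {k, l}"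
    using shifts_subset_doubleton[OF assms(2), of C] assms(3) by (auto simp: convex_ngon_def)
  \<comment> \<open>The intersection is empty when \<open>j \<ge> n\<close>, a case that \<open>kl\<close> does not rule out.\<close>
  have two: "\<exists>x y. solutions n A C j \<inter> {B. j < n} \<subseteq> {x, y}" for j
    using solutions_subset_doubleton[OF assms(2)] by (cases "j < n") auto
  obtain x y where xy: "solutions n A C k \<inter> {B. k < n} \<subseteq> {x, y}" using two by blast
  obtain z w where zw: "solutions n A C l \<inter> {B. l < n} \<subseteq> {z, w}" using two by blast
  have "?S \<subseteq> {x, y, z, w}"
  proof
    fix B assume "B \<in> ?S"
    then obtain j where j: "j < n" "B \<in> solutions n A C j" using sub by blast
    then have "j \<in> {k, l}" using kl by blast
    then show "B \<in> {x, y, z, w}" using j xy zw by blast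
  qed
  moreover have "card {x, y, z, w} \<le> 4"
    by (simp add: card_insert_if)
  ultimately show ?thesis
    by (meson card_mono finite.emptyI finite.insertI finite_subset le_trans)
qed

end
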